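(* Let $\mathbb{V}$ be a vector space of dimension $n\ge 1$ over the field of $q\ge 3$ elements, with basis $\{b_1,\dots,b_n\}$, and let $G(\mathbb{V})$ be its non-zero component graph. Then $fxd(G(\mathbb{V}))=|G(\mathbb{V})|-1$, where $|G(\mathbb{V})|$ denotes the number of vertices of $G(\mathbb{V})$.
   Context: The non-zero component graph $G(\mathbb{V})$ (with respect to the basis $\{b_1,\dots,b_n\}$) has as vertices the non-zero vectors of $\mathbb{V}$; two distinct vertices are adjacent iff some $b_j$ has non-zero coefficient in both of their expansions in the basis. For a graph $G$, a set $D\subseteq V(G)$ is a fixing set of $G$ if the only automorphism of $G$ that fixes every vertex of $D$ is the identity. The fixed number $fxd(G)$ is the minimum number $k$ such that every subset of $V(G)$ of cardinality $k$ is a fixing set of $G$. *)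

theory Defs
  imports
    "Graph_Theory.Pair_Digraph"
    "Graph_Theory.Digraph_Isomorphism"
    "HOL-Library.Cardinality"
begin

text \<open>
  A simple graph is a loop-free \<^typ>\<open>'a pair_pre_digraph\<close> whose arc relation is symmetric, the
  edge between \<open>u\<close> and \<open>v\<close> being the two arcs \<open>(u, v)\<close> and \<open>(v, u)\<close>.

  The values of an automorphism outside the vertex set are irrelevant.  Since
  the head and tail maps of \<^term>\<open>with_proj G\<close> are the projections, the arc map of
  an isomorphism onto \<^term>\<open>with_proj G\<close> is determined on arcs by its vertex map \<open>f\<close>; see
  \<open>graph_automorphism_iff\<close> below for the elementary description.
\<close>

definition graph_automorphism :: "'v pair_pre_digraph \<Rightarrow> ('v \<Rightarrow> 'v) \<Rightarrow> bool" where
  "graph_automorphism G f \<longleftrightarrow>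
     (\<exists>\<phi>. pre_digraph.digraph_isomorphism (with_proj G) \<phi> \<and>
          app_iso \<phi> (with_proj G) = with_proj G \<and> iso_verts \<phi> = f)"

definition fixing_set :: "'v pair_pre_digraph \<Rightarrow> 'v set \<Rightarrow> bool" where
  "fixing_set G D \<longleftrightarrow> D \<subseteq> pverts G \<and>
     (\<forall>f. graph_automorphism G f \<and> (\<forall>v\<in>D. f v = v) \<longrightarrow> (\<forall>v\<in>pverts G. f v = v))"

text \<open>
  The condition on \<open>k\<close> is vacuous for \<open>k\<close> larger than the number of vertices, but for a finite
  graph it also holds at \<open>k = card (pverts G)\<close>, so vacuity never affects the minimum
  (\<open>fixed_number_le_card\<close> below).
\<close>

definition fixed_number :: "'v pair_pre_digraph \<Rightarrow> nat" where
  "fixed_number G =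
     (LEAST k. \<forall>D. D \<subseteq> pverts G \<and> finite D \<and> card D = k \<longrightarrow> fixing_set G D)"

definition (in vector_space) nonzero_component_graph :: "'b set \<Rightarrow> 'b pair_pre_digraph" where
  "nonzero_component_graph B =
     \<lparr> pverts = {v. v \<noteq> 0},
       parcs = {(u, v). u \<noteq> 0 \<and> v \<noteq> 0 \<and> u \<noteq> v \<and>
                  (\<exists>b\<in>B. representation B u b \<noteq> 0 \<and> representation B v b \<noteq> 0)} \<rparr>"

lemma (in vector_space) pair_bidirected_digraph_nonzero_component_graph:
  "pair_bidirected_digraph (nonzero_component_graph B)"
  by unfold_locales
    (auto simp: nonzero_component_graph_def symmetric_def intro!: symI)

lemma (in pair_wf_digraph) graph_automorphism_iff:
  "graph_automorphism G f \<longleftrightarrow>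
     bij_betw f (pverts G) (pverts G) \<and>
     (\<forall>u\<in>pverts G. \<forall>v\<in>pverts G. (u, v) \<in> parcs G \<longleftrightarrow> (f u, f v) \<in> parcs G)"
  (is "?L \<longleftrightarrow> ?R")
proof
  assume ?L
  then obtain \<phi> where iso: "pre_digraph.digraph_isomorphism (with_proj G) \<phi>"
    and app: "app_iso \<phi> (with_proj G) = with_proj G" and f: "iso_verts \<phi> = f"
    by (auto simp: graph_automorphism_def)
  have V: "f ` pverts G = pverts G" and A: "iso_arcs \<phi> ` parcs G = parcs G"
    and t: "iso_tail \<phi> = fst" and h: "iso_head \<phi> = snd"
    using app f by (auto simp: app_iso_def with_proj_def)
  have inj: "inj_on f (pverts G)"
    using iso f by (simp add: pre_digraph.digraph_isomorphism_def)
  have arc: "iso_arcs \<phi> (u, v) = (f u, f v)" if "(u, v) \<in> parcs G" for u v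
    using iso f t h that by (fastforce simp: pre_digraph.digraph_isomorphism_def intro: prod_eqI)
  have "(u, v) \<in> parcs G \<longleftrightarrow> (f u, f v) \<in> parcs G" if uv: "u \<in> pverts G" "v \<in> pverts G" for u v
  proof
    assume "(u, v) \<in> parcs G"
    then show "(f u, f v) \<in> parcs G" using A arc imageI[of "(u, v)" "parcs G" "iso_arcs \<phi>"] by simp
  next
    assume "(f u, f v) \<in> parcs G"
    then obtain e where e: "e \<in> parcs G" "(f u, f v) = iso_arcs \<phi> e"
      using A by blast
    obtain x y where "e = (x, y)" by fastforce
    with e arc[of x y] have xy: "(x, y) \<in> parcs G" "f u = f x" "f v = f y" by simp_all
    then have "u = x" "v = y"
      using inj_onD[OF inj] uv in_arcsD1 in_arcsD2 by blast+
    with xy show "(u, v) \<in> parcs G" by simp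
  qed
  with inj V show ?R by (auto simp: bij_betw_def)
next
  assume R: ?R
  define \<phi> where "\<phi> = \<lparr> iso_verts = f, iso_arcs = map_prod f f, iso_head = snd, iso_tail = fst \<rparr>"
  have inj: "inj_on f (pverts G)" and V: "f ` pverts G = pverts G"
    using R by (auto simp: bij_betw_def)
  have sub: "parcs G \<subseteq> pverts G \<times> pverts G"
    by (auto dest: in_arcsD1 in_arcsD2)
  have inj2: "inj_on (map_prod f f) (parcs G)"
    using map_prod_inj_on[OF inj inj] sub by (rule inj_on_subset)
  have "map_prod f f ` parcs G = parcs G"
  proof
    show "map_prod f f ` parcs G \<subseteq> parcs G" using R sub by auto
    show "parcs G \<subseteq> map_prod f f ` parcs G"
    proof
      fix e assume e: "e \<in> parcs G"
      obtain x y where xy: "e = (x, y)" by (cases e)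
      have "x \<in> f ` pverts G" "y \<in> f ` pverts G"
        using e in_arcsD1 in_arcsD2 unfolding xy V by simp_all
      then obtain u v where uv: "u \<in> pverts G" "v \<in> pverts G" "x = f u" "y = f v"
        by (elim imageE)
      then have "(u, v) \<in> parcs G" using R e xy by simp
      then have "map_prod f f (u, v) \<in> map_prod f f ` parcs G" by (rule imageI)
      then show "e \<in> map_prod f f ` parcs G" using xy uv by simp
    qed
  qed
  then show ?L
    unfolding graph_automorphism_def
    using inj inj2 V wf_digraph
    by (intro exI[of _ \<phi>]) (simp add: \<phi>_def pre_digraph.digraph_isomorphism_def app_iso_def with_proj_def)
qed

lemma fixed_number_le_card:
  assumes "finite (pverts G)"
  shows "fixed_number G \<le> card (pverts G)"
  unfolding fixed_number_def
  using assms by (intro Least_le) (auto simp: fixing_set_def dest: card_subset_eq)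

end

theory Submission
  imports Defs
begin

text \<open>
  A non-zero vector and a scalar multiple of it by a non-zero factor have the same support, so
  they are twins in the non-zero component graph, and the transposition exchanging them is an
  automorphism.  As \<open>q \<ge> 3\<close>, each non-zero vector has such a twin.  Hence no set avoiding a pair of
  twins is fixing, whereas a permutation that moves at most one vertex is the identity.
\<close>

text \<open>An automorphism that moves \<open>v\<close> also moves \<open>f v\<close>, by
  injectivity, so a set of vertices it fixes pointwise misses at least two vertices and is too small
  to be \<open>D\<close>.\<close>

lemma (in pair_wf_digraph) fixing_setI:
  assumes fin: "finite (pverts G)" and D: "D \<subseteq> pverts G" "card (pverts G) - 1 \<le> card D"
  shows "fixing_set G D"
  unfolding fixing_set_def
proof (intro conjI allI impI ballI D)
  fix f v
  assume f: "graph_automorphism G f \<and> (\<forall>v\<in>D. f v = v)" and v: "v \<in> pverts G"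
  have bij: "bij_betw f (pverts G) (pverts G)"
    using f graph_automorphism_iff by blast
  show "f v = v"
  proof (rule ccontr)
    assume ne: "f v \<noteq> v"
    have fv: "f v \<in> pverts G"
      using bij v by (rule bij_betw_apply)
    have "f (f v) \<noteq> f v"
      using bij ne v fv by (auto simp: bij_betw_def dest: inj_onD)
    then have "D \<subseteq> pverts G - {v, f v}"
      using f ne D by auto
    then have "card D \<le> card (pverts G - {v, f v})"
      using fin by (intro card_mono) auto
    also have "\<dots> = card (pverts G) - 2"
      using v fv ne by (subst card_Diff_subset) auto
    \<comment> \<open>Subtraction on \<open>nat\<close> truncates: with fewer than two vertices,
      subtracting 1 or 2 would both give 0 and there would be no contradiction.\<close>
    moreover have "2 \<le> card (pverts G)"
      using card_mono[OF fin, of "{v, f v}"] v fv ne by simp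
    ultimately show False
      using D by linarith
  qed
qed

text \<open>Only arcs with exactly one end in \<open>{u, v}\<close> need the twin condition. It
  ranges over the other vertices only, so \<open>u\<close> and \<open>v\<close> may themselves be
  adjacent.\<close>

lemma (in pair_bidirected_digraph) graph_automorphism_transpose:
  assumes uv: "u \<in> pverts G" "v \<in> pverts G"
    and twins: "\<And>w. w \<in> pverts G - {u, v} \<Longrightarrow> (u, w) \<in> parcs G \<longleftrightarrow> (v, w) \<in> parcs G"
  shows "graph_automorphism G (transpose u v)"
  unfolding graph_automorphism_iff
proof (intro conjI ballI)
  show "bij_betw (transpose u v) (pverts G) (pverts G)"
    using uv by (simp add: bij_betw_transpose_iff)
  fix x y
  assume xy: "x \<in> pverts G" "y \<in> pverts G"
  have sym: "(a, b) \<in> parcs G \<longleftrightarrow> (b, a) \<in> parcs G" for a b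
    using arcs_symmetric by blast
  have loop: "(a, a) \<notin> parcs G" for a
    using no_loops by fastforce
  consider "x = u" "y = u" | "x = u" "y = v" | "x = v" "y = u" | "x = v" "y = v"
    | "x \<in> {u, v}" "y \<notin> {u, v}" | "x \<notin> {u, v}" "y \<in> {u, v}" | "x \<notin> {u, v}" "y \<notin> {u, v}"
    by blast
  then show "(x, y) \<in> parcs G \<longleftrightarrow> (transpose u v x, transpose u v y) \<in> parcs G"
  proof cases
    case 5
    then show ?thesis
      using twins[of y] xy by (auto simp: transpose_def)
  next
    case 6
    then show ?thesis
      using twins[of x] xy sym[of x u] sym[of x v] by (auto simp: transpose_def)
  \<comment> \<open>Inside \<open>{u, v}\<close> the transposition reverses arcs or permutes the
    absent loops; outside it moves nothing.\<close>
  qed (use loop sym[of u v] in \<open>auto simp: transpose_def\<close>)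
qed

text \<open>Sets missing a single vertex are fixing, while for each smaller size some set avoids
  both twins and is fixed pointwise by their transposition.\<close>

lemma (in pair_bidirected_digraph) fixed_number_eq_card_minus_1:
  assumes fin: "finite (pverts G)"
    and uv: "u \<in> pverts G" "v \<in> pverts G" "u \<noteq> v"
    and twins: "\<And>w. w \<in> pverts G - {u, v} \<Longrightarrow> (u, w) \<in> parcs G \<longleftrightarrow> (v, w) \<in> parcs G"
  shows "fixed_number G = card (pverts G) - 1"
  unfolding fixed_number_def
proof (rule Least_equality)
  show "\<forall>D. D \<subseteq> pverts G \<and> finite D \<and> card D = card (pverts G) - 1 \<longrightarrow> fixing_set G D"
    using fixing_setI[OF fin] by simp
next
  fix k
  assume k: "\<forall>D. D \<subseteq> pverts G \<and> finite D \<and> card D = k \<longrightarrow> fixing_set G D"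
  show "card (pverts G) - 1 \<le> k"
  proof (rule ccontr)
    assume "\<not> ?thesis"
    \<comment> \<open>As \<open>k\<close> is below \<open>card (pverts G) - 1\<close>, there is room
      for \<open>k\<close> vertices besides \<open>u\<close> and \<open>v\<close>.\<close>
    then have "k \<le> card (pverts G - {u, v})"
      using uv by (subst card_Diff_subset) auto
    then obtain D where D: "D \<subseteq> pverts G - {u, v}" "card D = k" "finite D"
      by (rule obtain_subset_with_card_n)
    then have "fixing_set G D"
      using k by blast
    moreover have "\<forall>w\<in>D. transpose u v w = w"
      using D by (auto simp: transpose_def)
    ultimately have "transpose u v u = u"
      using graph_automorphism_transpose[OF uv(1,2) twins] uv unfolding fixing_set_def by blast
    then show False
      using uv by simp
  qed
qed

lemma (in vector_space) finite_span:
  assumes "finite (UNIV :: 'a set)" and B: "finite B"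
  shows "finite (span B)"
proof (rule finite_surj)
  show "finite (Pi\<^sub>E B (\<lambda>_. UNIV :: 'a set))"
    using assms by (intro finite_PiE) auto
  show "span B \<subseteq> (\<lambda>c. \<Sum>x\<in>B. scale (c x) x) ` Pi\<^sub>E B (\<lambda>_. UNIV)"
  proof
    fix v assume "v \<in> span B"
    then obtain c where "v = (\<Sum>x\<in>B. scale (c x) x)"
      using span_finite[OF B] by auto
    then show "v \<in> (\<lambda>c. \<Sum>x\<in>B. scale (c x) x) ` Pi\<^sub>E B (\<lambda>_. UNIV)"
      \<comment> \<open>Restriction makes the coefficients \<open>undefined\<close> off
        \<open>B\<close>, as \<open>Pi\<^sub>E\<close> requires, and leaves the sum
        unchanged.\<close>
      by (intro image_eqI[of _ _ "restrict c B"]) (auto intro: sum.cong)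
  qed
qed

lemma (in vector_space) fixed_number_nonzero_component_graph:
  fixes c :: 'a and v :: 'b
  assumes fin: "finite (UNIV :: 'b set)"
    and B: "independent B" "span B = UNIV"
    and v: "v \<noteq> 0" and c: "c \<noteq> 0" "c \<noteq> 1"
  shows "fixed_number (nonzero_component_graph B) = card (pverts (nonzero_component_graph B)) - 1"
proof -
  interpret G: pair_bidirected_digraph "nonzero_component_graph B"
    by (rule pair_bidirected_digraph_nonzero_component_graph)
  have "scale c v \<noteq> v"
    using c v scale_cancel_right[of c v 1] by simp
  \<comment> \<open>The twin of \<open>v\<close> is \<open>scale c v\<close>: each coefficient is
    multiplied by \<open>c \<noteq> 0\<close>, so both vectors have the same support.\<close>
  then show ?thesis
    using fin v c B
    by (intro G.fixed_number_eq_card_minus_1[of v "scale c v"])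
      (auto simp: nonzero_component_graph_def representation_scale intro: finite_subset)
qed

theorem theorem4p6:
  fixes scale :: "'a :: {field, finite} \<Rightarrow> 'b :: ab_group_add \<Rightarrow> 'b"
    and b :: "nat \<Rightarrow> 'b"
    and n q :: nat
  assumes "vector_space scale"
    and "CARD('a) = q" and "q \<ge> 3"
    and "n \<ge> 1" and "vector_space.dim scale UNIV = n"
    and "inj_on b {1..n}"
    and "\<not> module.dependent scale (b ` {1..n})"
    and "module.span scale (b ` {1..n}) = UNIV"
  shows "fixed_number (vector_space.nonzero_component_graph scale (b ` {1..n})) =
           card (pverts (vector_space.nonzero_component_graph scale (b ` {1..n}))) - 1"
proof -
  interpret vector_space scale by fact
  let ?B = "b ` {1..n}"
  have B: "independent ?B" "span ?B = UNIV"
    using assms by auto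
  have fin: "finite (UNIV :: 'b set)"
    using finite_span[of ?B] B by simp
  have "b 1 \<in> ?B"
    using \<open>n \<ge> 1\<close> by auto
  then have b1: "b 1 \<noteq> 0"
    using B(1) dependent_zero by metis
  \<comment> \<open>Here \<open>q \<ge> 3\<close> enters: it leaves a scalar besides 0 and 1, which
    yields a twin distinct from the vector itself.\<close>
  have "card {0, 1 :: 'a} < CARD('a)"
    using assms by simp
  then have "{0, 1 :: 'a} \<noteq> UNIV"
    by (metis less_irrefl)
  then obtain c :: 'a where "c \<noteq> 0" "c \<noteq> 1"
    by auto
  with fin B b1 show ?thesis
    by (rule fixed_number_nonzero_component_graph)
qed

end
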